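(* Let $s\ge0$ be an integer, $h\in\mathbb C\setminus\{0\}$ and $q\in\mathbb C\setminus\{0\}$. For all $0\le k\le n$, $$S_{s,h,q}[n,k]=h^{n-k}q^{s\binom n2-(s-1)\binom k2-n+k}\sum_{j=k}^n[s]_{1/q}^{\,n-j}\bigl(-[s-1]_{1/q}\bigr)^{j-k}\,\hat c_{1/q^{s}}[n,j]\,\hat S_{1/q^{s-1}}[j,k].$$ Consequently, for $q=1$, writing $S_{s,h}(n,k)=S_{s,h,1}[n,k]$, $$S_{s,h}(n,k)=h^{n-k}\sum_{j=k}^ns^{n-j}(1-s)^{j-k}c(n,j)S(j,k),$$ where $c(n,k)$ and $S(n,k)$ are the classical (unsigned) Stirling numbers of the first kind and the Stirling numbers of the second kind, respectively. (Here $0^0=1$.)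
   Context: For an integer $x$ and $p\in\mathbb C\setminus\{0\}$, $[x]_p=\frac{p^x-1}{p-1}$ if $p\ne1$ and $[x]_1=x$. The numbers $S_{s,h,q}[n,k]$ are the coefficients in $(VU)^n=\sum_{k=0}^nS_{s,h,q}[n,k]V^{sn-(s-1)k}U^k$, where $UV-qVU=hV^s$; equivalently they are determined by $S_{s,h,q}[n,k]=q^{s(n-1)-(s-1)(k-1)}S_{s,h,q}[n-1,k-1]+h[s(n-1)-(s-1)k]_q\,S_{s,h,q}[n-1,k]$ for $n,k\ge1$, with $S_{s,h,q}[n,0]=S_{s,h,q}[0,n]=\delta_{0,n}$. For $p\in\mathbb C\setminus\{0\}$, $\hat S_p$ and $\hat c_p$ are defined for $n,k\geq 1$ by $\hat S_p[n,k]=\hat S_p[n-1,k-1]+[k]_p\hat S_p[n-1,k]$ and $\hat c_p[n,k]=\hat c_p[n-1,k-1]+[n-1]_p\hat c_p[n-1,k]$, with $\hat S_p[n,0]=\hat S_p[0,n]=\hat c_p[n,0]=\hat c_p[0,n]=\delta_{n,0}$. *)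

theory Defs
  imports Complex_Main "HOL-Combinatorics.Stirling"
begin

definition qbracket :: "complex \<Rightarrow> int \<Rightarrow> complex" where
  "qbracket p x = (if p = 1 then of_int x else (p powi x - 1) / (p - 1))"

text \<open>
  The numbers \<open>S\<^sub>s\<^sub>,\<^sub>h\<^sub>,\<^sub>q[n,k]\<close>, given by their recurrence with the index pair \<open>(n,k)\<close> written
  as \<open>(Suc n, Suc k)\<close>. Exponents and bracket arguments are integers because
  \<open>s - 1\<close> is negative for \<open>s = 0\<close>, and because \<open>s n - (s - 1) k\<close> can be negative when
  \<open>k > n\<close>. The lemma \<open>normal_ordering\<close> below shows that these are the
  normal ordering coefficients of \<open>(V U)\<^sup>n\<close>.
\<close>

fun gstirling :: "nat \<Rightarrow> complex \<Rightarrow> complex \<Rightarrow> nat \<Rightarrow> nat \<Rightarrow> complex" where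
  "gstirling s h q 0 0 = 1"
| "gstirling s h q 0 (Suc k) = 0"
| "gstirling s h q (Suc n) 0 = 0"
| "gstirling s h q (Suc n) (Suc k) =
     q powi (int s * int n - (int s - 1) * int k) * gstirling s h q n k
     + h * qbracket q (int s * int n - (int s - 1) * int (Suc k)) * gstirling s h q n (Suc k)"

fun qStirling2 :: "complex \<Rightarrow> nat \<Rightarrow> nat \<Rightarrow> complex" where
  "qStirling2 p 0 0 = 1"
| "qStirling2 p 0 (Suc k) = 0"
| "qStirling2 p (Suc n) 0 = 0"
| "qStirling2 p (Suc n) (Suc k) =
     qStirling2 p n k + qbracket p (int (Suc k)) * qStirling2 p n (Suc k)"

fun qstirling1 :: "complex \<Rightarrow> nat \<Rightarrow> nat \<Rightarrow> complex" where
  "qstirling1 p 0 0 = 1"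
| "qstirling1 p 0 (Suc k) = 0"
| "qstirling1 p (Suc n) 0 = 0"
| "qstirling1 p (Suc n) (Suc k) =
     qstirling1 p n k + qbracket p (int n) * qstirling1 p n (Suc k)"

lemma qbracket_Suc:
  assumes "q \<noteq> 0"
  shows "qbracket q (int (Suc a)) = q ^ a + qbracket q (int a)"
  using assms by (auto simp: qbracket_def field_simps power_int_add)

lemma gstirling_eq_0: "n < k \<Longrightarrow> gstirling s h q n k = 0"
proof (induction n arbitrary: k)
  case 0
  then show ?case by (cases k) auto
next
  case (Suc n)
  then show ?case by (cases k) auto
qed

text \<open>
  The algebra is an arbitrary ring \<open>'a\<close> made into a complex algebra by a homomorphism \<open>\<iota>\<close>
  from the complex numbers into its centre. For \<open>k \<le> n\<close> the exponent \<open>s n - (s - 1) k\<close>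
  equals the natural number \<open>s (n - k) + k\<close>.
\<close>

lemma normal_ordering:
  fixes U V :: "'a::ring_1" and \<iota> :: "complex \<Rightarrow> 'a"
  assumes add: "\<And>x y. \<iota> (x + y) = \<iota> x + \<iota> y"
    and mult: "\<And>x y. \<iota> (x * y) = \<iota> x * \<iota> y"
    and one: "\<iota> 1 = 1"
    and central: "\<And>x a. \<iota> x * a = a * \<iota> x"
    and comm: "U * V - \<iota> q * V * U = \<iota> h * V ^ s"
    and q: "q \<noteq> 0"
  shows "(V * U) ^ n = (\<Sum>k\<le>n. \<iota> (gstirling s h q n k) * V ^ (s * (n - k) + k) * U ^ k)"
proof (induction n)
  case 0
  show ?case by (simp add: one)
next
  case (Suc n)
  have zero: "\<iota> 0 = 0" using add[of 0 0] by simp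
  have UV: "U * V = \<iota> q * V * U + \<iota> h * V ^ s"
    using comm by (simp add: algebra_simps)
  have shift: "V * U * V ^ a = \<iota> (q ^ a) * V ^ Suc a * U + \<iota> (h * qbracket q (int a)) * V ^ (a + s)" for a
  proof (induction a)
    case 0
    show ?case by (simp add: one qbracket_def zero)
  next
    case (Suc a)
    have "V * U * V ^ Suc a = (V * U * V ^ a) * V"
      by (simp only: power_Suc2 mult.assoc)
    also have "\<dots> = \<iota> (q ^ a) * V ^ Suc a * (U * V) + \<iota> (h * qbracket q (int a)) * V ^ (a + s) * V"
      unfolding Suc.IH distrib_right by (simp only: mult.assoc)
    also have "\<dots> = \<iota> (q ^ a) * (V ^ Suc a * \<iota> q) * V * U + \<iota> (q ^ a) * (V ^ Suc a * \<iota> h) * V ^ s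
        + \<iota> (h * qbracket q (int a)) * V ^ (a + s) * V"
      by (simp only: UV distrib_left mult.assoc)
    also have "\<dots> = \<iota> (q ^ a) * (\<iota> q * V ^ Suc a) * V * U + \<iota> (q ^ a) * (\<iota> h * V ^ Suc a) * V ^ s
        + \<iota> (h * qbracket q (int a)) * V ^ (a + s) * V"
      by (simp only: central)
    also have "\<dots> = \<iota> (q ^ Suc a) * V ^ Suc (Suc a) * U
        + (\<iota> (h * q ^ a) + \<iota> (h * qbracket q (int a))) * V ^ (Suc a + s)"
    proof -
      have 1: "\<iota> (q ^ a) * (\<iota> q * V ^ Suc a) * V * U = \<iota> (q ^ Suc a) * V ^ Suc (Suc a) * U"
        by (simp only: power_Suc2 mult mult.assoc)
      have 2: "\<iota> (q ^ a) * (\<iota> h * V ^ Suc a) * V ^ s = \<iota> (h * q ^ a) * V ^ (Suc a + s)"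
        by (simp only: power_add mult mult.assoc mult.commute[of h])
      have 3: "x * V ^ (a + s) * V = x * V ^ (Suc a + s)" for x
        by (simp only: add_Suc power_Suc2 mult.assoc)
      show ?thesis by (simp only: 1 2 3 distrib_right add.assoc)
    qed
    also have "\<iota> (h * q ^ a) + \<iota> (h * qbracket q (int a)) = \<iota> (h * qbracket q (int (Suc a)))"
      by (simp only: add[symmetric] distrib_left[symmetric] qbracket_Suc[OF q])
    finally show ?case .
  qed
  define e where "e k = s * (n - k) + k" for k
  define A where "A k = gstirling s h q n k * q ^ e k" for k
  define B where "B k = h * qbracket q (int (e k)) * gstirling s h q n k" for k
  have e: "int (e k) = int s * int n - (int s - 1) * int k" if "k \<le> n" for k
    unfolding e_def of_nat_add of_nat_mult of_nat_diff[OF that] by (simp add: algebra_simps)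
  have rec: "gstirling s h q (Suc n) (Suc k) = A k + B (Suc k)" if "k \<le> n" for k
  proof -
    have 1: "q powi (int s * int n - (int s - 1) * int k) = q ^ e k"
      using e[OF that] by (metis power_int_of_nat)
    have 2: "h * qbracket q (int s * int n - (int s - 1) * int (Suc k)) * gstirling s h q n (Suc k) = B (Suc k)"
    proof (cases "Suc k \<le> n")
      case True
      then show ?thesis unfolding B_def by (subst e) auto
    next
      case False
      then show ?thesis by (simp add: B_def gstirling_eq_0)
    qed
    show ?thesis unfolding gstirling.simps 1 2 by (simp add: A_def)
  qed
  have summand: "V * U * (\<iota> (gstirling s h q n k) * V ^ e k * U ^ k)
      = \<iota> (A k) * V ^ Suc (e k) * U ^ Suc k + \<iota> (B k) * V ^ (e k + s) * U ^ k" for k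
  proof -
    have "V * U * (\<iota> (gstirling s h q n k) * V ^ e k * U ^ k)
        = \<iota> (gstirling s h q n k) * (V * U * V ^ e k) * U ^ k"
      by (metis central mult.assoc)
    also have "\<dots> = \<iota> (gstirling s h q n k) * \<iota> (q ^ e k) * V ^ Suc (e k) * (U * U ^ k)
        + \<iota> (gstirling s h q n k) * \<iota> (h * qbracket q (int (e k))) * V ^ (e k + s) * U ^ k"
      unfolding shift distrib_left distrib_right by (simp only: mult.assoc)
    also have "\<dots> = \<iota> (A k) * V ^ Suc (e k) * U ^ Suc k + \<iota> (B k) * V ^ (e k + s) * U ^ k"
      by (simp only: mult[symmetric] A_def B_def power_Suc mult.commute[of "gstirling s h q n k"])
    finally show ?thesis .
  qed
  have B0: "B 0 = 0"
    by (cases n) (simp_all add: B_def e_def qbracket_def)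
  have Bn: "B (Suc n) = 0"
    by (simp add: B_def gstirling_eq_0)
  have "(V * U) ^ Suc n = (\<Sum>k\<le>n. V * U * (\<iota> (gstirling s h q n k) * V ^ e k * U ^ k))"
    by (simp only: power_Suc Suc.IH sum_distrib_left e_def)
  also have "\<dots> = (\<Sum>k\<le>n. \<iota> (A k) * V ^ Suc (e k) * U ^ Suc k)
      + (\<Sum>k\<le>n. \<iota> (B k) * V ^ (e k + s) * U ^ k)"
    by (simp only: summand sum.distrib)
  also have "(\<Sum>k\<le>n. \<iota> (B k) * V ^ (e k + s) * U ^ k)
      = (\<Sum>k\<le>Suc n. \<iota> (B k) * V ^ (s * (Suc n - k) + k) * U ^ k)"
    by (auto simp: Bn zero e_def Suc_diff_le add_ac intro!: sum.cong)
  also have "\<dots> = (\<Sum>k\<le>n. \<iota> (B (Suc k)) * V ^ (s * (n - k) + Suc k) * U ^ Suc k)"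
    by (subst sum.atMost_Suc_shift) (simp add: B0 zero)
  also have "(\<Sum>k\<le>n. \<iota> (A k) * V ^ Suc (e k) * U ^ Suc k) + \<dots>
      = (\<Sum>k\<le>n. \<iota> (gstirling s h q (Suc n) (Suc k)) * V ^ (s * (Suc n - Suc k) + Suc k) * U ^ Suc k)"
    unfolding sum.distrib[symmetric]
    by (intro sum.cong refl) (simp only: rec atMost_iff add distrib_right e_def diff_Suc_Suc add_Suc_right)
  also have "\<dots> = (\<Sum>k\<le>Suc n. \<iota> (gstirling s h q (Suc n) k) * V ^ (s * (Suc n - k) + k) * U ^ k)"
    by (subst sum.atMost_Suc_shift) (simp add: zero)
  finally show ?case .
qed

end

theory Submission
  imports Defs
begin

text \<open>
  The factorisation \<open>[a]\<^sub>p [b]\<^bsub>p^a\<^esub> = [a b]\<^sub>p\<close> absorbs the powers of \<open>[s]\<^bsub>1/q\<^esub>\<close> and \<open>-[s-1]\<^bsub>1/q\<^esub>\<close> into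
  the two \<open>q\<close>-Stirling triangles, which then have the weights \<open>[s n]\<^bsub>1/q\<^esub>\<close> (depending on the
  row) and \<open>-[(s-1) k]\<^bsub>1/q\<^esub>\<close> (depending on the column). The product of two such triangles
  satisfies the triangular recurrence whose weight is the sum of the two weights, and
  \<open>q\<^bsup>x-1\<^esup> ([x]\<^bsub>1/q\<^esub> - [y]\<^bsub>1/q\<^esub>) = [x - y]\<^sub>q\<close> identifies it with the recurrence of the normal
  ordering coefficients.
\<close>

lemma qbracket_one [simp]: "qbracket 1 x = of_int x"
  by (simp add: qbracket_def)

text \<open>For \<open>p \<noteq> 1\<close>, the denominator of the second bracket cancels the
  numerator of the first. If \<open>p powi a = 1\<close>, both sides vanish.\<close>

lemma qbracket_mult:
  assumes "p \<noteq> 0"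
  shows "qbracket p a * qbracket (p powi a) b = qbracket p (a * b)"
  using assms by (auto simp: qbracket_def power_int_mult)

text \<open>For \<open>q \<noteq> 1\<close>, the bracket of \<open>x\<close> at \<open>1 / q\<close>
  is q(1 - q^(-x))/(q - 1), so the constant terms cancel in the difference.\<close>

lemma qbracket_inverse_diff:
  assumes "q \<noteq> 0"
  shows "q powi (x - 1) * (qbracket (1 / q) x - qbracket (1 / q) y) = qbracket q (x - y)"
proof (cases "q = 1")
  case False
  then have "1 / q - 1 \<noteq> 0" "q - 1 \<noteq> 0" "1 - q \<noteq> 0"
    using assms by (auto simp: field_simps)
  then show ?thesis
    using assms False
    by (simp add: qbracket_def power_int_diff power_int_divide_distrib divide_simps)
      (simp add: algebra_simps)
qed simp

lemma qstirling1_eq_0: "n < k \<Longrightarrow> qstirling1 p n k = 0"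
proof (induction n arbitrary: k)
  case 0
  then show ?case by (cases k) auto
next
  case (Suc n)
  then show ?case by (cases k) auto
qed

lemma qStirling2_eq_0: "n < k \<Longrightarrow> qStirling2 p n k = 0"
proof (induction n arbitrary: k)
  case 0
  then show ?case by (cases k) auto
next
  case (Suc n)
  then show ?case by (cases k) auto
qed

lemma qstirling1_one: "qstirling1 1 n k = of_nat (stirling n k)"
  by (induction "1::complex" n k rule: qstirling1.induct) auto

lemma qStirling2_one: "qStirling2 1 n k = of_nat (Stirling n k)"
  by (induction "1::complex" n k rule: qStirling2.induct) (auto simp: algebra_simps)

text \<open>For \<open>j < n\<close> one factor leaves the power and merges with the bracket of
  \<open>n\<close> in base \<open>p powi a\<close>. Otherwise the exponents truncate to 0 and the
  entry at \<open>Suc j\<close> is 0.\<close>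

lemma scaled_qstirling1_Suc:
  assumes "p \<noteq> 0"
  shows "qbracket p a ^ (Suc n - Suc j) * qstirling1 (p powi a) (Suc n) (Suc j)
    = qbracket p a ^ (n - j) * qstirling1 (p powi a) n j
      + qbracket p (a * int n) * (qbracket p a ^ (n - Suc j) * qstirling1 (p powi a) n (Suc j))"
proof (cases "j < n")
  case True
  then have "n - j = Suc (n - Suc j)" by simp
  then show ?thesis
    by (simp add: algebra_simps flip: qbracket_mult[OF assms])
qed (simp add: qstirling1_eq_0)

lemma scaled_qStirling2_Suc:
  assumes "p \<noteq> 0"
  shows "(- qbracket p a) ^ (Suc j - Suc k) * qStirling2 (p powi a) (Suc j) (Suc k)
    = (- qbracket p a) ^ (j - k) * qStirling2 (p powi a) j k
      + (- qbracket p (a * int (Suc k)))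
        * ((- qbracket p a) ^ (j - Suc k) * qStirling2 (p powi a) j (Suc k))"
proof (cases "k < j")
  case True
  then have "j - k = Suc (j - Suc k)" by simp
  then show ?thesis
    by (simp add: algebra_simps del: of_nat_Suc flip: qbracket_mult[OF assms])
qed (simp add: qStirling2_eq_0)

text \<open>The weight \<open>a\<close> belongs to a row of \<open>C\<close> and \<open>b\<close> to
  a column of \<open>D\<close>; neither depends on the summation index, so both leave the
  sum.\<close>

lemma triangle_product_Suc:
  fixes C D :: "nat \<Rightarrow> nat \<Rightarrow> 'a::comm_ring_1"
  assumes C_Suc: "\<And>j. C (Suc n) (Suc j) = C n j + a * C n (Suc j)"
    and C_0: "C (Suc n) 0 = 0" and C_diag: "C n (Suc n) = 0"
    and D_Suc: "\<And>j. D (Suc j) (Suc k) = D j k + b * D j (Suc k)"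
    and D_0: "D 0 (Suc k) = 0"
  shows "(\<Sum>j\<le>Suc n. C (Suc n) j * D j (Suc k))
    = (\<Sum>j\<le>n. C n j * D j k) + (a + b) * (\<Sum>j\<le>n. C n j * D j (Suc k))"
proof -
  \<comment> \<open>Reindexing loses the term at 0 and gains the one at \<open>Suc n\<close>; both
    are 0.\<close>
  have shift: "(\<Sum>j\<le>n. C n (Suc j) * D (Suc j) (Suc k)) = (\<Sum>j\<le>n. C n j * D j (Suc k))"
    using sum.atMost_Suc_shift[of "\<lambda>j. C n j * D j (Suc k)" n] by (simp add: C_diag D_0)
  have "(\<Sum>j\<le>Suc n. C (Suc n) j * D j (Suc k))
      = (\<Sum>j\<le>n. (C n j + a * C n (Suc j)) * D (Suc j) (Suc k))"
    by (subst sum.atMost_Suc_shift) (simp add: C_0 C_Suc)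
  also have "\<dots> = (\<Sum>j\<le>n. C n j * D (Suc j) (Suc k)) + a * (\<Sum>j\<le>n. C n (Suc j) * D (Suc j) (Suc k))"
    by (simp add: distrib_right sum.distrib sum_distrib_left mult.assoc)
  also have "(\<Sum>j\<le>n. C n j * D (Suc j) (Suc k))
      = (\<Sum>j\<le>n. C n j * D j k) + b * (\<Sum>j\<le>n. C n j * D j (Suc k))"
    by (simp add: D_Suc distrib_left sum.distrib sum_distrib_left mult.left_commute)
  finally show ?thesis by (simp add: shift algebra_simps)
qed

text \<open>Leaving \<open>k\<close> free and summing from 0 lets the induction on \<open>n\<close>
  use the recurrence at every entry, also above the diagonal.\<close>

lemma gstirling_eq:
  assumes "q \<noteq> 0"
  shows "gstirling s h q n k =
      h ^ (n - k)
      * q powi (int s * int (n choose 2) - (int s - 1) * int (k choose 2) - int n + int k)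
      * (\<Sum>j\<le>n. (qbracket (1 / q) (int s) ^ (n - j) * qstirling1 ((1 / q) powi int s) n j)
            * ((- qbracket (1 / q) (int s - 1)) ^ (j - k)
               * qStirling2 ((1 / q) powi (int s - 1)) j k))"
proof -
  have p: "1 / q \<noteq> 0" using assms by simp
  define C where
    "C n j = qbracket (1 / q) (int s) ^ (n - j) * qstirling1 ((1 / q) powi int s) n j" for n j
  define D where
    "D j k = (- qbracket (1 / q) (int s - 1)) ^ (j - k)
      * qStirling2 ((1 / q) powi (int s - 1)) j k" for j k
  define T where "T n k = (\<Sum>j\<le>n. C n j * D j k)" for n k
  define E where
    "E n k = int s * int (n choose 2) - (int s - 1) * int (k choose 2) - int n + int k" for n k
  have T_Suc: "T (Suc n) (Suc k) = T n k
      + (qbracket (1 / q) (int s * int n) - qbracket (1 / q) ((int s - 1) * int (Suc k))) * T n (Suc k)"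
    for n k
    unfolding T_def diff_conv_add_uminus[of "qbracket (1 / q) (int s * int n)"]
  proof (rule triangle_product_Suc)
    show "C (Suc n) (Suc j) = C n j + qbracket (1 / q) (int s * int n) * C n (Suc j)" for j
      unfolding C_def by (rule scaled_qstirling1_Suc[OF p])
    show "D (Suc j) (Suc k)
        = D j k + - qbracket (1 / q) ((int s - 1) * int (Suc k)) * D j (Suc k)" for j
      unfolding D_def by (rule scaled_qStirling2_Suc[OF p])
  qed (simp_all add: C_def D_def qstirling1_eq_0)
  have T_eq_0: "T n k = 0" if "n < k" for n k
    using that by (simp add: T_def D_def qStirling2_eq_0)
  have T_0: "T (Suc n) 0 = 0" for n
    unfolding T_def by (subst sum.atMost_Suc_shift) (simp add: C_def D_def)
  have "gstirling s h q n k = h ^ (n - k) * q powi E n k * T n k"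
  proof (induction n arbitrary: k)
    case 0
    show ?case
      by (cases k) (simp_all add: E_def T_def C_def D_def binomial_eq_0)
  next
    case (Suc n)
    show ?case
    proof (cases k)
      case 0
      then show ?thesis by (simp add: T_0)
    next
      case (Suc m)
      define x where "x = int s * int n"
      define y where "y = (int s - 1) * int (Suc m)"
      \<comment> \<open>Pascal's rule gives both increments. The part \<open>- int n + int k\<close>
        is constant along the diagonal and drops by 1 down a column, whence the \<open>x - 1\<close>
        that \<open>qbracket_inverse_diff\<close> needs.\<close>
      have E1: "E (Suc n) (Suc m) = (int s * int n - (int s - 1) * int m) + E n m"
        by (simp add: E_def numeral_2_eq_2 algebra_simps)
      have E2: "E (Suc n) (Suc m) = (x - 1) + E n (Suc m)"
        by (simp add: E_def x_def numeral_2_eq_2 algebra_simps)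
      \<comment> \<open>Where subtraction truncates, \<open>T n (Suc m)\<close> is 0.\<close>
      have h: "h * (h ^ (n - Suc m) * T n (Suc m)) = h ^ (n - m) * T n (Suc m)"
      proof (cases "m < n")
        case True
        then have "n - m = Suc (n - Suc m)" by simp
        then show ?thesis by simp
      qed (simp add: T_eq_0)
      have "gstirling s h q (Suc n) (Suc m)
          = q powi (int s * int n - (int s - 1) * int m) * q powi E n m * (h ^ (n - m) * T n m)
            + qbracket q (x - y) * q powi E n (Suc m) * (h * (h ^ (n - Suc m) * T n (Suc m)))"
        by (simp only: gstirling.simps Suc.IH x_def y_def ac_simps)
      also have "\<dots> = q powi E (Suc n) (Suc m) * (h ^ (n - m) * T n m)
          + q powi E (Suc n) (Suc m) * (qbracket (1 / q) x - qbracket (1 / q) y)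
            * (h ^ (n - m) * T n (Suc m))"
      proof -
        have 1: "q powi E (Suc n) (Suc m) = q powi (int s * int n - (int s - 1) * int m) * q powi E n m"
          unfolding E1 using assms by (simp add: power_int_add)
        have 2: "q powi E (Suc n) (Suc m) = q powi (x - 1) * q powi E n (Suc m)"
          unfolding E2 using assms by (simp add: power_int_add)
        have "q powi E (Suc n) (Suc m) * (qbracket (1 / q) x - qbracket (1 / q) y)
            = qbracket q (x - y) * q powi E n (Suc m)"
          unfolding 2 qbracket_inverse_diff[OF assms, symmetric] by (simp only: mult_ac)
        then show ?thesis by (simp only: h 1[symmetric])
      qed
      also have "\<dots> = h ^ (Suc n - Suc m) * q powi E (Suc n) (Suc m) * T (Suc n) (Suc m)"
        unfolding T_Suc x_def y_def by (simp only: diff_Suc_Suc distrib_left ac_simps)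
      finally show ?thesis by (simp only: Suc)
    qed
  qed
  then show ?thesis unfolding E_def T_def C_def D_def .
qed

theorem corollary3:
  fixes s n k :: nat and h q :: complex
  assumes "h \<noteq> 0" and "q \<noteq> 0" and "k \<le> n"
  shows "gstirling s h q n k =
      h ^ (n - k)
      * q powi (int s * int (n choose 2) - (int s - 1) * int (k choose 2) - int n + int k)
      * (\<Sum>j=k..n. qbracket (1 / q) (int s) ^ (n - j)
            * (- qbracket (1 / q) (int s - 1)) ^ (j - k)
            * qstirling1 (1 / q ^ s) n j
            * qStirling2 (1 / q powi (int s - 1)) j k)
    \<and> gstirling s h 1 n k =
      h ^ (n - k)
      * (\<Sum>j=k..n. of_nat s ^ (n - j) * (1 - of_nat s) ^ (j - k)
            * of_nat (stirling n j) * of_nat (Stirling j k))"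
proof -
  have *: "gstirling s h r n k =
      h ^ (n - k)
      * r powi (int s * int (n choose 2) - (int s - 1) * int (k choose 2) - int n + int k)
      * (\<Sum>j=k..n. qbracket (1 / r) (int s) ^ (n - j)
            * (- qbracket (1 / r) (int s - 1)) ^ (j - k)
            * qstirling1 (1 / r ^ s) n j
            * qStirling2 (1 / r powi (int s - 1)) j k)" if "r \<noteq> 0" for r
  proof -
    have powi: "(1 / r) powi int s = 1 / r ^ s" "(1 / r) powi (int s - 1) = 1 / r powi (int s - 1)"
      by (simp_all add: power_int_divide_distrib power_one_over)
    show ?thesis
      unfolding gstirling_eq[OF that] powi
      \<comment> \<open>The terms with \<open>j < k\<close> vanish through
        \<open>qStirling2\<close>.\<close>
      by (rule arg_cong[where f = "(*) _"], rule sum.mono_neutral_cong_right)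
        (simp, fastforce, force simp: qStirling2_eq_0, simp only: mult_ac)
  qed
  \<comment> \<open>At \<open>r = 1\<close> every power of \<open>r\<close> is 1 and the brackets
    become \<open>s\<close> and \<open>s - 1\<close>.\<close>
  from *[OF assms(2)] *[of 1] show ?thesis
    by (simp add: qstirling1_one qStirling2_one)
qed

end
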